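(* For every integer $n\ge 4$, $\left\lfloor \frac{2n-5}{3}\right\rfloor\leq c_2(n,K_4)\leq \left\lfloor \frac{2n-3}{3}\right\rfloor$. Furthermore, for every integer $n> 98$, $$c_2(n, K_4) = \left\lfloor \frac{2n-5}{3}\right\rfloor.$$
   Context: A $3$-graph $G=(V,E)$ consists of a finite vertex set $V$ and a set $E$ of $3$-element subsets of $V$ (its edges). A subgraph of $G$ is a $3$-graph $H$ with $V(H)\subseteq V(G)$ and $E(H)\subseteq E(G)$; a copy of $F$ in $G$ is a (not necessarily induced) subgraph of $G$ isomorphic to $F$. The codegree $d(x,y)$ of a pair of distinct vertices is the number of edges containing both $x$ and $y$, and $\delta_2(G)$ is the minimum of $d(x,y)$ over all pairs of distinct vertices. $G$ has an $F$-covering if every vertex of $G$ lies in at least one copy of $F$ in $G$. For a $3$-graph $F$ with at least one edge and an integer $n\ge |V(F)|$, $$c_2(n,F)=\max\{\delta_2(G): |V(G)|=n \text{ and } G \text{ does not have an } F\text{-covering}\}.$$ $K_4$ denotes the complete $3$-graph on $4$ vertices (all four triples are edges). *)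

theory Defs
  imports Complex_Main
begin

record 'a hypergraph =
  verts :: "'a set"
  edges :: "'a set set"

definition three_graph :: "'a hypergraph \<Rightarrow> bool" where
  "three_graph G \<longleftrightarrow> finite (verts G) \<and> edges G \<subseteq> {e. e \<subseteq> verts G \<and> card e = 3}"

definition subgraph :: "'a hypergraph \<Rightarrow> 'a hypergraph \<Rightarrow> bool" where
  "subgraph H G \<longleftrightarrow> three_graph H \<and> verts H \<subseteq> verts G \<and> edges H \<subseteq> edges G"

definition isomorphic :: "'a hypergraph \<Rightarrow> 'b hypergraph \<Rightarrow> bool" where
  "isomorphic F H \<longleftrightarrow>
     (\<exists>f. bij_betw f (verts F) (verts H) \<and> edges H = (\<lambda>e. f ` e) ` edges F)"

definition copy_of :: "'b hypergraph \<Rightarrow> 'a hypergraph \<Rightarrow> 'a hypergraph \<Rightarrow> bool" where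
  "copy_of F G H \<longleftrightarrow> subgraph H G \<and> isomorphic F H"

definition has_covering :: "'b hypergraph \<Rightarrow> 'a hypergraph \<Rightarrow> bool" where
  "has_covering F G \<longleftrightarrow> (\<forall>v\<in>verts G. \<exists>H. copy_of F G H \<and> v \<in> verts H)"

definition codegree :: "'a hypergraph \<Rightarrow> 'a \<Rightarrow> 'a \<Rightarrow> nat" where
  "codegree G x y = card {e \<in> edges G. x \<in> e \<and> y \<in> e}"

(* Meaningful only when G has at least two vertices. *)
definition min_codegree :: "'a hypergraph \<Rightarrow> nat" where
  "min_codegree G = Min {codegree G x y | x y. x \<in> verts G \<and> y \<in> verts G \<and> x \<noteq> y}"

(* Host graphs have vertices in nat, which loses no generality since vertex sets are
   finite and all notions are isomorphism invariant.  If F has an edge and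
   n \<ge> card (verts F), the set is finite and contains 0 (edgeless host graph),
   so Max is a genuine maximum. *)
definition c2 :: "nat \<Rightarrow> 'b hypergraph \<Rightarrow> nat" where
  "c2 n F = Max {min_codegree G | G :: nat hypergraph.
     three_graph G \<and> card (verts G) = n \<and> \<not> has_covering F G}"

definition K4 :: "nat hypergraph" where
  "K4 = \<lparr>verts = {0..<4}, edges = {e. e \<subseteq> {0..<4} \<and> card e = 3}\<rparr>"

end

theory Submission
  imports Defs
begin

text \<open>
  Let $x$ be a vertex of a 3-graph $G$ on $n$ vertices with minimum codegree $m$, and suppose that
  no copy of $K_4$ contains $x$. Everything is read off from one ordinary graph on the other
  $n - 1$ vertices, the complement $H$ of the link of $x$: two vertices $y, z$ are adjacent in $H$
  if $xyz$ is not an edge of $G$. The codegree of $x$ and $y$ is $n - 2$ minus the degree of $y$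
  in $H$, so all degrees in $H$ are at most $D = n - 2 - m$. If $y, z$ are not adjacent in $H$,
  then $xyz$ is an edge, and for every other edge $yzw$ of $G$ the vertex $w$ is adjacent in $H$ to
  $y$ or to $z$, because otherwise $x, y, z, w$ would span a $K_4$. Counting such $w$ gives
  \[ m + |N(y) \cap N(z)| \le 1 + |N(y)| + |N(z)|, \]
  where $N$ denotes neighbourhoods in $H$ (lemma \<open>codegree_le_of_uncovered\<close>). Bounding both
  degrees by $D$ yields $3m \le 2n - 3$, which is the general upper bound.

  If $3m$ exceeds $2n - 5$, only $3m = 2n - 3 - s$ with $s \le 1$ remains. Then $H$ has
  $3D + 2 - s$ vertices, and the inequality reads
  $2D + |N(y) \cap N(z)| \le |N(y)| + |N(z)| + s$. Such an $H$ wants to be a disjoint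
  union of cliques with about $D$ vertices each, and for $D \ge 5$ the numbers do not fit
  (the locale \<open>near_clique_union\<close>):
  \<^item> If nonadjacent vertices never had common neighbours, three independent vertices would have
    disjoint closed neighbourhoods with more vertices in total than there are.
  \<^item> So some vertex $c$ has two nonadjacent neighbours. Nonadjacent vertices share at most
    one neighbour, which makes $N(c)$ a disjoint union of cliques, and leaves at most $2D$ edges from
    $N(c)$ to the non-neighbours of $c$. That forces $N(c)$ to be a clique on $D - 1$
    vertices together with one isolated vertex $w$ (lemma \<open>neighbourhood_structure\<close>). The
    edge $cw$ lies in no triangle; it is called a bridge, and a vertex is on at most one bridge.
  \<^item> Now $c$ and $w$ lie in two disjoint cliques on $D$ vertices. Each of the other
    $2(D - 1)$ clique vertices starts a bridge into the remaining at most $D + 2$ vertices, and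
    bridges from the same clique end in different vertices. Hence two bridges, one from each clique,
    meet in a vertex, a contradiction.

  For the lower bound, take a vertex whose link is a complete tripartite graph with parts as equal
  as possible, and let the remaining edges be all other triples except those that meet all three
  parts. The triangles of the link are exactly the missing triples, so the vertex is not covered.
\<close>

section \<open>Copies of the tetrahedron and codegrees\<close>

lemma image_subsets_of_card:
  assumes "bij_betw f A B"
  shows "(\<lambda>e. f ` e) ` {e. e \<subseteq> A \<and> card e = k} = {e. e \<subseteq> B \<and> card e = k}"
proof -
  have inj: "inj_on f A" and im: "f ` A = B" using assms by (auto simp: bij_betw_def)
  have card: "card (f ` e) = card e" if "e \<subseteq> A" for e
    using inj_on_subset[OF inj that] by (rule card_image)
  show ?thesis
  proof (intro equalityI subsetI)
    fix e' assume e': "e' \<in> {e. e \<subseteq> B \<and> card e = k}"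
    then obtain e where "e \<subseteq> A" "e' = f ` e" unfolding im[symmetric] by (auto elim: subset_imageE)
    then show "e' \<in> (\<lambda>e. f ` e) ` {e. e \<subseteq> A \<and> card e = k}" using card e' by auto
  qed (use card im in auto)
qed

text \<open>
  This replaces isomorphic copies by four-element vertex sets all of whose triples are edges.
\<close>

lemma in_copy_of_K4_iff:
  "(\<exists>H. copy_of K4 G H \<and> v \<in> verts H) \<longleftrightarrow>
   (\<exists>S\<subseteq>verts G. card S = 4 \<and> v \<in> S \<and> (\<forall>e\<subseteq>S. card e = 3 \<longrightarrow> e \<in> edges G))"
  (is "?L \<longleftrightarrow> ?R")
proof
  assume ?L
  then obtain H f where H: "subgraph H G" "v \<in> verts H"
    and f: "bij_betw f {0..<4::nat} (verts H)"
    and e: "edges H = (\<lambda>e. f ` e) ` {e. e \<subseteq> {0..<4} \<and> card e = 3}"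
    unfolding copy_of_def isomorphic_def K4_def by auto
  have "edges H = {e. e \<subseteq> verts H \<and> card e = 3}"
    using e image_subsets_of_card[OF f] by simp
  moreover have "card (verts H) = 4" using bij_betw_same_card[OF f] by simp
  ultimately show ?R using H by (intro exI[of _ "verts H"]) (auto simp: subgraph_def)
next
  assume ?R
  then obtain S where S: "S \<subseteq> verts G" "card S = 4" "v \<in> S"
    and E: "\<And>e. e \<subseteq> S \<Longrightarrow> card e = 3 \<Longrightarrow> e \<in> edges G" by blast
  have fin: "finite S" using S(2) card.infinite by fastforce
  obtain f where f: "bij_betw f {0..<4::nat} S"
    using finite_same_card_bij[of "{0..<4::nat}" S] fin S by auto
  define H where "H = \<lparr>verts = S, edges = {e. e \<subseteq> S \<and> card e = 3}\<rparr>"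
  have "isomorphic K4 H"
    using f image_subsets_of_card[OF f] unfolding isomorphic_def K4_def H_def
    by (intro exI[of _ f]) simp
  moreover have "subgraph H G"
    using S E fin by (auto simp: subgraph_def three_graph_def H_def)
  ultimately show ?L using S(3) by (intro exI[of _ H]) (auto simp: copy_of_def H_def)
qed

lemma edge_distinct:
  assumes "three_graph G" "{a, b, c} \<in> edges G"
  shows "a \<noteq> b" "b \<noteq> c" "a \<noteq> c" "a \<in> verts G" "b \<in> verts G" "c \<in> verts G"
proof -
  have c: "card {a, b, c} = 3" and "{a, b, c} \<subseteq> verts G"
    using assms by (auto simp: three_graph_def)
  then show "a \<in> verts G" "b \<in> verts G" "c \<in> verts G" by auto
  have "a \<noteq> b \<and> b \<noteq> c \<and> a \<noteq> c"
    using c by (auto simp: card_insert_if split: if_splits)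
  then show "a \<noteq> b" "b \<noteq> c" "a \<noteq> c" by auto
qed

lemma codegree_eq_card_third_vertices:
  assumes G: "three_graph G" and "a \<noteq> b"
  shows "codegree G a b = card {c \<in> verts G. {a, b, c} \<in> edges G}"
proof -
  have "bij_betw (\<lambda>c. {a, b, c}) {c \<in> verts G. {a, b, c} \<in> edges G} {e \<in> edges G. a \<in> e \<and> b \<in> e}"
    unfolding bij_betw_def
  proof (intro conjI inj_onI equalityI subsetI)
    fix c d assume "c \<in> {c \<in> verts G. {a, b, c} \<in> edges G}" "d \<in> {c \<in> verts G. {a, b, c} \<in> edges G}"
      and eq: "{a, b, c} = {a, b, d}"
    then show "c = d" using edge_distinct[OF G, of a b c] edge_distinct[OF G, of a b d] by auto
  next
    fix e assume e: "e \<in> {e \<in> edges G. a \<in> e \<and> b \<in> e}"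
    then have "card e = 3" "e \<subseteq> verts G" using G by (auto simp: three_graph_def)
    moreover have "card (e - {a, b}) = 1"
      using e \<open>a \<noteq> b\<close> \<open>card e = 3\<close> by (subst card_Diff_subset) auto
    then obtain c where "e - {a, b} = {c}" by (auto simp: card_1_singleton_iff)
    then have "e = {a, b, c}" using e by auto
    ultimately show "e \<in> (\<lambda>c. {a, b, c}) ` {c \<in> verts G. {a, b, c} \<in> edges G}" using e by auto
  qed auto
  then show ?thesis unfolding codegree_def by (rule bij_betw_same_card[symmetric])
qed

lemma min_codegree_ge_iff:
  assumes G: "three_graph G" and "2 \<le> card (verts G)"
  shows "m \<le> min_codegree G \<longleftrightarrow>
    (\<forall>a\<in>verts G. \<forall>b\<in>verts G. a \<noteq> b \<longrightarrow> m \<le> codegree G a b)"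
proof -
  let ?S = "{codegree G x y | x y. x \<in> verts G \<and> y \<in> verts G \<and> x \<noteq> y}"
  have fin: "finite (verts G)" using G by (simp add: three_graph_def)
  have "?S \<subseteq> (\<lambda>(x, y). codegree G x y) ` (verts G \<times> verts G)" by auto
  then have "finite ?S" using fin by (meson finite_SigmaI finite_imageI finite_subset)
  moreover obtain a b where "a \<in> verts G" "b \<in> verts G" "a \<noteq> b"
    using assms(2) by (metis card_le_Suc0_iff_eq fin not_less_eq_eq numeral_2_eq_2)
  then have "?S \<noteq> {}" by blast
  ultimately show ?thesis unfolding min_codegree_def by (subst Min_ge_iff) auto
qed

section \<open>Graphs that are almost disjoint unions of three cliques\<close>

text \<open>
  The graph is given by its vertex set \<open>W\<close> and its neighbourhood function \<open>N\<close>. It stands for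
  the complement of the link of an uncovered vertex, \<open>D\<close> for the largest degree that the minimum
  codegree permits, and \<open>s\<close> for the amount by which three times the minimum codegree stays below
  its maximal value. The purpose of the locale is to be refuted. The two cases are handled together:
  for \<open>s = 0\<close> the graph would be a disjoint union of cliques on \<open>D + 1\<close> vertices, and the real work
  is in \<open>s = 1\<close>.
\<close>

locale near_clique_union =
  fixes W :: "'a set" and N :: "'a \<Rightarrow> 'a set" and D s :: nat
  assumes finite_W: "finite W"
    and N_subset: "N v \<subseteq> W"
    and N_irrefl: "v \<notin> N v"
    and N_sym: "u \<in> N v \<Longrightarrow> v \<in> N u"
    and D_ge: "5 \<le> D"
    and s_le: "s \<le> 1"
    and card_W: "card W + s = 3 * D + 2"
    and card_N_le: "v \<in> W \<Longrightarrow> card (N v) \<le> D"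
    and codegree_le: "u \<in> W \<Longrightarrow> v \<in> W \<Longrightarrow> u \<noteq> v \<Longrightarrow> v \<notin> N u \<Longrightarrow>
      2 * D + card (N u \<inter> N v) \<le> card (N u) + card (N v) + s"
begin

lemma finite_N [simp]: "finite (N v)"
  using finite_W N_subset finite_subset by blast

lemma N_in_W: "u \<in> N v \<Longrightarrow> u \<in> W" "u \<in> N v \<Longrightarrow> v \<in> W"
  using N_subset N_sym by blast+

lemma card_insert_N: "card (insert v (N v)) = card (N v) + 1"
  using N_irrefl by simp

text \<open>
  Two closed neighbourhoods have at most \<open>2 * D + 2\<close> vertices together, so a greedy choice works.
\<close>

lemma three_independent_vertices:
  obtains u v w where "u \<in> W" "v \<in> W" "w \<in> W" "u \<noteq> v" "u \<noteq> w" "v \<noteq> w"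
    "v \<notin> N u" "w \<notin> N u" "w \<notin> N v"
proof -
  let ?C = "\<lambda>v. insert v (N v)"
  have W: "card W \<ge> 2 * D + 3" using card_W s_le D_ge by linarith
  then obtain u where u: "u \<in> W" using card.empty by fastforce
  have uD: "card (?C u) \<le> D + 1" using card_N_le[OF u] by (simp add: card_insert_N)
  then have "card (?C u) < card W" using W by linarith
  then obtain v where v: "v \<in> W" "v \<notin> ?C u"
    by (metis finite_N finite_insert card_mono leD subsetI)
  have vD: "card (?C v) \<le> D + 1" using card_N_le[OF v(1)] by (simp add: card_insert_N)
  have "card (?C u \<union> ?C v) \<le> card (?C u) + card (?C v)" by (rule card_Un_le)
  then have "card (?C u \<union> ?C v) < card W" using W uD vD by linarith
  moreover have "finite (?C u \<union> ?C v)" by simp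
  ultimately obtain w where "w \<in> W" "w \<notin> ?C u \<union> ?C v"
    by (metis card_mono leD subsetI)
  then show ?thesis using that u v by blast
qed

lemma degree_ge: "v \<in> W \<Longrightarrow> D \<le> card (N v) + 1"
proof -
  assume v: "v \<in> W"
  have "card (insert v (N v)) < card W"
    using card_N_le[OF v] card_W s_le D_ge card_insert_N[of v] by linarith
  then obtain u where "u \<in> W" "u \<notin> insert v (N v)"
    by (metis finite_N finite_insert card_mono leD subsetI)
  then show ?thesis using codegree_le[of v u] v card_N_le[of u] s_le by force
qed

text \<open>
  Since \<open>s \<le> 1\<close>, a common neighbour of nonadjacent vertices leaves no room in the codegree
  inequality: it is the only one, and both degrees are maximal. This is the fact used most often
  below, usually to refute a second common neighbour.
\<close>

lemma path_of_length_two: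
  assumes "u \<noteq> v" "v \<notin> N u" "c \<in> N u" "c \<in> N v"
  shows "N u \<inter> N v = {c}" "card (N u) = D" "card (N v) = D" "s = 1"
proof -
  have W: "u \<in> W" "v \<in> W" using assms N_in_W by blast+
  have sub: "{c} \<subseteq> N u \<inter> N v" using assms by auto
  have "card {c} \<le> card (N u \<inter> N v)" using sub by (intro card_mono) auto
  then have *: "card (N u \<inter> N v) = 1 \<and> card (N u) = D \<and> card (N v) = D \<and> s = 1"
    using codegree_le[OF W assms(1,2)] card_N_le[OF W(1)] card_N_le[OF W(2)] s_le by simp
  show "N u \<inter> N v = {c}"
    using card_subset_eq[OF _ sub] * by simp
  show "card (N u) = D" "card (N v) = D" "s = 1" using * by auto
qed

text \<open>
  Otherwise three independent vertices have disjoint closed neighbourhoods. Adding up the codegree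
  inequalities for the three pairs gives a degree sum of at least \<open>3 * D - s\<close>, because twice that
  sum is at least \<open>6 * D - 3 * s\<close> and \<open>s \<le> 1\<close>. With the three vertices themselves this
  exceeds the size \<open>3 * D + 2 - s\<close> of \<open>W\<close>.
\<close>

lemma exists_path_of_length_two:
  obtains u v c where "u \<noteq> v" "v \<notin> N u" "c \<in> N u" "c \<in> N v"
proof -
  have False if no: "\<And>u v. u \<noteq> v \<Longrightarrow> v \<notin> N u \<Longrightarrow> N u \<inter> N v = {}"
  proof -
    obtain u v w where W: "u \<in> W" "v \<in> W" "w \<in> W" and ne: "u \<noteq> v" "u \<noteq> w" "v \<noteq> w"
      and na: "v \<notin> N u" "w \<notin> N u" "w \<notin> N v" by (rule three_independent_vertices)
    let ?C = "\<lambda>v. insert v (N v)"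
    have disj: "?C a \<inter> ?C b = {}" if "a \<noteq> b" "b \<notin> N a" for a b
      using no[OF that] that N_sym[of a b] by auto
    have dw: "(?C u \<union> ?C v) \<inter> ?C w = {}" using disj ne na by blast
    have "card (?C u \<union> ?C v \<union> ?C w) = card (?C u \<union> ?C v) + card (?C w)"
      by (rule card_Un_disjoint) (use dw in auto)
    also have "card (?C u \<union> ?C v) = card (?C u) + card (?C v)"
      by (rule card_Un_disjoint) (use disj ne na in auto)
    finally have "card (N u) + card (N v) + card (N w) + 3 = card (?C u \<union> ?C v \<union> ?C w)"
      by (simp add: card_insert_N)
    also have "\<dots> \<le> card W" using W N_subset finite_W by (intro card_mono) auto
    finally show False
      using card_W s_le codegree_le[OF W(1,2) ne(1) na(1)] codegree_le[OF W(1,3) ne(2) na(2)]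
        codegree_le[OF W(2,3) ne(3) na(3)] by linarith
  qed
  then show ?thesis using that by blast
qed

text \<open>
  If \<open>p\<close> and \<open>r\<close> were nonadjacent, both \<open>c\<close> and \<open>q\<close> would be common neighbours. Hence
  every neighbourhood induces a disjoint union of cliques.
\<close>

lemma neighbourhood_transitive:
  assumes "p \<in> N c" "q \<in> N c" "r \<in> N c" "q \<in> N p" "r \<in> N q" "p \<noteq> r"
  shows "r \<in> N p"
proof (rule ccontr)
  assume "r \<notin> N p"
  then have "N p \<inter> N r = {c}"
    using path_of_length_two(1)[of p r c] assms N_sym[of p c] N_sym[of r c] by simp
  then show False using assms(2,4) N_sym[OF assms(5)] N_irrefl[of c] by auto
qed

text \<open>
  A neighbourhood that is not a clique is nearly one. Within \<open>N c\<close>, a vertex in a clique of size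
  \<open>a\<close> sends \<open>D - a\<close> edges to the non-neighbours of \<open>c\<close>, and each non-neighbour receives at
  most one such edge. As there are only \<open>2 * D\<close> non-neighbours, the average of \<open>D - a\<close> over the
  \<open>D\<close> vertices of \<open>N c\<close> is at most 2. If no clique had size at least \<open>D - 1\<close>, all would have
  size exactly \<open>D - 2\<close>, and two of those do not fit into \<open>D\<close> vertices when \<open>D \<ge> 5\<close>.
\<close>

lemma neighbourhood_structure:
  assumes "u \<in> N c" "v \<in> N c" "u \<noteq> v" "v \<notin> N u"
  obtains w where "w \<in> N c" "N c \<inter> N w = {}" "card (N c) = D"
    "\<And>p q. p \<in> N c - {w} \<Longrightarrow> q \<in> N c - {w} \<Longrightarrow> p \<noteq> q \<Longrightarrow> q \<in> N p"
proof -
  have cu: "c \<in> N u" "c \<in> N v" using assms N_sym by auto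
  have c: "c \<in> W" using assms N_in_W by blast
  have uv: "N u \<inter> N v = {c}" using path_of_length_two(1)[OF assms(3,4) cu] .
  have s: "s = 1" using path_of_length_two(4)[OF assms(3,4) cu] .
  \<comment> \<open>A common neighbour of \<open>u\<close> and \<open>v\<close> inside \<open>N c\<close> would be a second one besides \<open>c\<close>.\<close>
  have non_nbr: "\<exists>y\<in>N c. y \<noteq> x \<and> y \<notin> N x" if "x \<in> N c" for x
  proof (cases "x = u \<or> x = v")
    case True
    then show ?thesis using assms N_sym[of u v] by metis
  next
    case False
    have "x \<notin> N u \<inter> N v" using uv that N_irrefl[of c] by auto
    then have "u \<notin> N x \<or> v \<notin> N x" using N_sym[of u x] N_sym[of v x] by auto
    then show ?thesis using assms False by auto
  qed
  have degN: "card (N x) = D" if x: "x \<in> N c" for x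
  proof -
    obtain y where "y \<in> N c" "y \<noteq> x" "y \<notin> N x" using non_nbr[OF x] by blast
    then show ?thesis using path_of_length_two(2)[of x y c] N_sym[OF x] N_sym[of y c] by auto
  qed
  \<comment> \<open>\<open>A x\<close> is the clique of \<open>x\<close> in \<open>N c\<close>, and \<open>Out x\<close> its set of neighbours at distance two from \<open>c\<close>.\<close>
  define A where "A = (\<lambda>x. insert x (N x \<inter> N c))"
  define Out where "Out = (\<lambda>x. N x - insert c (N c))"
  have A_sub: "A x \<subseteq> N c" if "x \<in> N c" for x using that by (auto simp: A_def)
  have cardA: "card (A x) + card (Out x) = D" if x: "x \<in> N c" for x
  proof -
    have "N x = insert c (N x \<inter> N c) \<union> Out x" using x N_sym by (auto simp: Out_def)
    then have "card (N x) = card (insert c (N x \<inter> N c) \<union> Out x)" by simp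
    also have "\<dots> = card (insert c (N x \<inter> N c)) + card (Out x)"
      by (rule card_Un_disjoint) (auto simp: Out_def)
    finally have "card (N x) = card (insert c (N x \<inter> N c)) + card (Out x)" .
    moreover have "card (insert c (N x \<inter> N c)) = card (N x \<inter> N c) + 1"
      using N_irrefl by simp
    moreover have "card (A x) = card (N x \<inter> N c) + 1"
      using N_irrefl by (simp add: A_def)
    ultimately show ?thesis using degN[OF x] by simp
  qed
  have A_lt: "card (A x) < card (N c)" if "x \<in> N c" for x
  proof (rule psubset_card_mono)
    show "A x \<subset> N c" using A_sub[OF that] non_nbr[OF that] by (auto simp: A_def)
  qed simp
  \<comment> \<open>A vertex at distance two from \<open>c\<close> forces \<open>c\<close> to have full degree. Such a vertex exists,
    since otherwise all \<open>D\<close> neighbours of \<open>u\<close> lie in the closed neighbourhood of \<open>c\<close>, which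
    would have at most \<open>D\<close> vertices and contains the non-neighbour \<open>v\<close>.\<close>
  have cD: "card (N c) = D"
  proof (rule ccontr)
    assume "card (N c) \<noteq> D"
    then have lt: "card (N c) < D" using card_N_le[OF c] by simp
    then have "card (Out u) > 0" using cardA[OF assms(1)] A_lt[OF assms(1)] lt by linarith
    then obtain z where z: "z \<in> Out u" by (metis card.empty ex_in_conv less_nat_zero_code)
    then have "card (N c) = D"
      using path_of_length_two(2)[of c z u] assms(1) N_sym[of z u] by (auto simp: Out_def)
    then show False using lt by simp
  qed
  have A_disj: "A x \<inter> A y = {}" if "x \<in> N c" "y \<in> N c" "x \<noteq> y" "y \<notin> N x" for x y
  proof -
    have "N x \<inter> N y = {c}" using path_of_length_two(1)[of x y c] that N_sym[of x c] N_sym[of y c] by simp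
    moreover have "(N x \<inter> N c) \<inter> (N y \<inter> N c) = (N x \<inter> N y) \<inter> N c" by blast
    ultimately have "(N x \<inter> N c) \<inter> (N y \<inter> N c) = {}" using N_irrefl[of c] by simp
    moreover have "x \<notin> N y" using that(4) N_sym[of x y] by blast
    ultimately show ?thesis using that(3,4) unfolding A_def by blast
  qed
  have outside: "(\<Sum>x\<in>N c. card (Out x)) \<le> 2 * D"
  proof -
    have "Out x \<inter> Out y = {}" if "x \<in> N c" "y \<in> N c" "x \<noteq> y" for x y
    proof (rule ccontr)
      assume ne: "Out x \<inter> Out y \<noteq> {}"
      obtain z where "z \<in> Out x" "z \<in> Out y" using ne by blast
      then have z: "z \<in> N x" "z \<in> N y" "z \<noteq> c" "z \<notin> N c" by (simp_all add: Out_def)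
      then have "N c \<inter> N z = {x}" using path_of_length_two(1)[of c z x] that N_sym[of z x] by auto
      moreover have "y \<in> N c \<inter> N z" using that(2) N_sym[OF z(2)] by blast
      ultimately show False using that(3) by simp
    qed
    then have "(\<Sum>x\<in>N c. card (Out x)) = card (\<Union>x\<in>N c. Out x)"
      by (intro card_UN_disjoint[symmetric]) (auto simp: Out_def)
    also have "\<dots> \<le> card (W - insert c (N c))"
      using finite_W N_subset by (intro card_mono) (auto simp: Out_def)
    also have "\<dots> = card W - (D + 1)"
      using c N_subset cD card_insert_N[of c] by (subst card_Diff_subset) auto
    also have "\<dots> \<le> 2 * D" using card_W s by linarith
    finally show ?thesis .
  qed
  have "\<exists>x\<in>N c. D \<le> card (A x) + 1"
  proof (rule ccontr)
    assume "\<not> ?thesis"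
    then have small: "card (A x) + 2 \<le> D" if "x \<in> N c" for x using that by force
    have "card (A u) + card (A v) = card (A u \<union> A v)"
      using A_disj[OF assms] by (intro card_Un_disjoint[symmetric]) (auto simp: A_def)
    also have "\<dots> \<le> card (N c)"
      using A_sub assms by (intro card_mono) auto
    finally have "card (A u) + card (A v) \<le> D" using cD by simp
    then have "card (Out u) > 2 \<or> card (Out v) > 2"
      using cardA[OF assms(1)] cardA[OF assms(2)] D_ge by linarith
    then have "\<exists>x\<in>N c. card (Out x) > 2" using assms(1,2) by blast
    moreover have "card (Out x) \<ge> 2" if "x \<in> N c" for x using cardA[OF that] small[OF that] by linarith
    ultimately have "(\<Sum>x\<in>N c. 2) < (\<Sum>x\<in>N c. card (Out x))"
      by (intro sum_strict_mono_ex1) auto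
    then show False using outside cD by simp
  qed
  then obtain x where x: "x \<in> N c" "D \<le> card (A x) + 1" by blast
  have "card (N c - A x) = 1"
    using x A_sub[OF x(1)] A_lt[OF x(1)] cD by (subst card_Diff_subset) (auto simp: A_def)
  then obtain w where "N c - A x = {w}" by (auto simp: card_1_singleton_iff)
  then have w: "w \<in> N c" "w \<notin> A x" and Nc: "N c - {w} = A x" using A_sub[OF x(1)] by auto
  have clique: "q \<in> N p" if "p \<in> N c - {w}" "q \<in> N c - {w}" "p \<noteq> q" for p q
  proof (rule ccontr)
    assume "q \<notin> N p"
    have pq: "p \<in> N c" "q \<in> N c" "p \<in> A x" "q \<in> A x" using that Nc by auto
    have "p \<notin> N q" using \<open>q \<notin> N p\<close> N_sym by blast
    then have "p \<noteq> x" "q \<noteq> x" using pq(3,4) that(3) \<open>q \<notin> N p\<close> unfolding A_def by blast+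
    then have "p \<in> N x" "q \<in> N x" using pq(3,4) unfolding A_def by blast+
    then show False
      using neighbourhood_transitive[OF pq(1) x(1) pq(2)] N_sym that(3) \<open>q \<notin> N p\<close> by blast
  qed
  moreover have "N c \<inter> N w = {}"
  proof -
    have "w \<noteq> x" "w \<notin> N x" using w by (auto simp: A_def)
    then have "A x \<inter> A w = {}" using A_disj[OF x(1) w(1)] by blast
    then have "(N c - {w}) \<inter> (N w \<inter> N c) = {}" unfolding Nc by (auto simp: A_def)
    then show ?thesis using N_irrefl[of w] by blast
  qed
  ultimately show ?thesis using that w(1) cD by blast
qed

definition bridge :: "'a \<Rightarrow> 'a \<Rightarrow> bool" where
  "bridge c w \<longleftrightarrow> w \<in> N c \<and> N c \<inter> N w = {}"

lemma bridge_sym: "bridge c w \<Longrightarrow> bridge w c"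
  using N_sym by (auto simp: bridge_def)

text \<open>
  A vertex \<open>c\<close> on a bridge has a further neighbour, not adjacent to \<open>w\<close>, so its neighbourhood has
  the structure found above. The exceptional vertex must be \<open>w\<close>, as all other vertices
  of \<open>N c\<close> have neighbours there.
\<close>

lemma bridge_neighbourhood:
  assumes "bridge c w"
  shows "card (N c) = D"
    and "p \<in> N c - {w} \<Longrightarrow> q \<in> N c - {w} \<Longrightarrow> p \<noteq> q \<Longrightarrow> q \<in> N p"
proof -
  have w: "w \<in> N c" "N c \<inter> N w = {}" using assms by (auto simp: bridge_def)
  have two: "\<exists>p. p \<in> N c \<and> p \<noteq> a \<and> p \<noteq> b" for a b
  proof (rule ccontr)
    assume "\<not> ?thesis"
    then have "card (N c) \<le> card {a, b}" by (intro card_mono) auto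
    also have "\<dots> \<le> 2" by (simp add: card_insert_if)
    finally show False using degree_ge[of c] N_in_W[OF w(1)] D_ge by linarith
  qed
  obtain x where x: "x \<in> N c" "x \<noteq> w" using two by blast
  then have "x \<notin> N w" using w by blast
  then obtain w' where w': "w' \<in> N c" "N c \<inter> N w' = {}" "card (N c) = D"
    "\<And>p q. p \<in> N c - {w'} \<Longrightarrow> q \<in> N c - {w'} \<Longrightarrow> p \<noteq> q \<Longrightarrow> q \<in> N p"
    using neighbourhood_structure[of w c x] w x by metis
  have "w' = w"
  proof (rule ccontr)
    assume "w' \<noteq> w"
    obtain q where "q \<in> N c" "q \<noteq> w" "q \<noteq> w'" using two by blast
    then have "q \<in> N w" using w'(4)[of w q] w \<open>w' \<noteq> w\<close> by auto
    then show False using w \<open>q \<in> N c\<close> by blast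
  qed
  then show "p \<in> N c - {w} \<Longrightarrow> q \<in> N c - {w} \<Longrightarrow> p \<noteq> q \<Longrightarrow> q \<in> N p"
    using w'(4)[of p q] by simp
  show "card (N c) = D" by (rule w'(3))
qed

text \<open>
  The other end of a second bridge would lie in the clique \<open>N c - {w}\<close>, hence in triangles with \<open>c\<close>.
\<close>

lemma bridge_unique:
  assumes "bridge c w" "bridge c w'"
  shows "w = w'"
proof (rule ccontr)
  assume ne: "w \<noteq> w'"
  have "card (N c - {w, w'}) \<ge> 1"
    using bridge_neighbourhood(1)[OF assms(1)] D_ge assms ne
    by (subst card_Diff_subset) (auto simp: bridge_def)
  then obtain q where "q \<in> N c - {w, w'}" by (metis card.empty ex_in_conv not_one_le_zero)
  then show False
    using bridge_neighbourhood(2)[OF assms(1), of w' q] assms ne by (auto simp: bridge_def)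
qed

text \<open>
  Each \<open>q\<close> in \<open>Q = N c - {w}\<close> has degree \<open>D\<close>, since \<open>q\<close> and \<open>w\<close> are nonadjacent with common
  neighbour \<open>c\<close>. Besides \<open>c\<close> and the rest of the clique \<open>Q\<close> it has exactly one more neighbour
  \<open>r\<close>, which lies outside the closed neighbourhood of \<open>c\<close>. That \<open>r\<close> is not adjacent to \<open>w\<close>, for then \<open>q\<close> and \<open>w\<close> would share \<open>c\<close> and \<open>r\<close>. Nor
  is it adjacent to another \<open>q'\<close> in \<open>Q\<close>, for then \<open>c\<close> and \<open>r\<close> would share \<open>q\<close> and \<open>q'\<close>.
  So the edge from \<open>q\<close> to \<open>r\<close> is a bridge, and different \<open>q\<close> give different \<open>r\<close>.
\<close>

lemma bridges_leaving_clique: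
  assumes "bridge c w"
  obtains F where "F \<subseteq> W - (N c \<union> N w)" "card F = D - 1"
    "\<And>r. r \<in> F \<Longrightarrow> \<exists>q\<in>N c. bridge r q"
proof -
  have w: "w \<in> N c" "N c \<inter> N w = {}" using assms by (auto simp: bridge_def)
  define Q where "Q = N c - {w}"
  have cQ: "card Q = D - 1" using bridge_neighbourhood(1)[OF assms] w by (simp add: Q_def)
  have cW: "c \<in> N w" using N_sym[OF w(1)] .
  have ex: "\<exists>r. r \<in> N q \<and> r \<notin> insert c (N c)" if "q \<in> Q" for q
  proof (rule ccontr)
    assume none: "\<not> ?thesis"
    have q: "q \<in> N c" "q \<noteq> w" "q \<notin> N w" using that w by (auto simp: Q_def)
    have "c \<in> N q" using N_sym[OF q(1)] .
    then have "card (N q) = D"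
      using path_of_length_two(2)[of q w c] q N_sym[of w q] cW by blast
    moreover have "N q \<subseteq> insert c (Q - {q})"
      using none N_irrefl[of q] N_sym[of w q] q(3) by (auto simp: Q_def)
    then have "card (N q) \<le> card (insert c (Q - {q}))" by (intro card_mono) (auto simp: Q_def)
    moreover have "\<dots> \<le> card (Q - {q}) + 1" by (simp add: card_insert_if Q_def)
    moreover have "card (Q - {q}) + 1 = D - 1" using that cQ D_ge by (simp add: Q_def)
    ultimately show False using D_ge by linarith
  qed
  then obtain f where f: "\<And>q. q \<in> Q \<Longrightarrow> f q \<in> N q" "\<And>q. q \<in> Q \<Longrightarrow> f q \<notin> insert c (N c)"
    by metis
  have only: "N c \<inter> N (f q) = {q}" if "q \<in> Q" for q
    using path_of_length_two(1)[of c "f q" q] f[OF that] that N_sym[of "f q" q] by (auto simp: Q_def)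
  have inj: "inj_on f Q" using only by (metis inj_onI singleton_inject)
  have "f ` Q \<subseteq> W - (N c \<union> N w)"
  proof
    fix r assume "r \<in> f ` Q"
    then obtain q where q: "q \<in> Q" "r = f q" by blast
    have "r \<notin> N w"
    proof
      assume r: "r \<in> N w"
      have "q \<noteq> w" "w \<notin> N q" "c \<in> N q"
        using q(1) w(2) N_sym[of w q] N_sym[of q c] by (auto simp: Q_def)
      then have "N q \<inter> N w = {c}" using path_of_length_two(1)[of q w c] cW by simp
      then show False using r f[OF q(1)] q by blast
    qed
    then show "r \<in> W - (N c \<union> N w)" using f[OF q(1)] q N_subset by blast
  qed
  moreover have "card (f ` Q) = D - 1" using inj cQ by (simp add: card_image)
  moreover have "\<exists>q\<in>N c. bridge r q" if "r \<in> f ` Q" for r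
  proof -
    obtain q where q: "q \<in> Q" "r = f q" using \<open>r \<in> f ` Q\<close> by blast
    have "N r \<inter> N q = {}"
    proof (rule ccontr)
      assume "N r \<inter> N q \<noteq> {}"
      then obtain z where z: "z \<in> N r" "z \<in> N q" by blast
      have "r \<notin> N c" using f q by blast
      then have zc: "z \<noteq> c" using z(1) N_sym[of c r] by blast
      have "z \<noteq> q" using z N_irrefl by blast
      then have "z \<notin> N c" using only[OF q(1)] z q by blast
      \<comment> \<open>So \<open>r\<close> and \<open>z\<close> are two neighbours of \<open>q\<close> outside its clique, one too many for its degree.\<close>
      then have "card (insert r (insert z (insert c (Q - {q})))) = D + 1"
        using z zc \<open>r \<notin> N c\<close> f[OF q(1)] q cQ D_ge N_irrefl[of c] N_irrefl[of r]
        by (auto simp: Q_def card_insert_if)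
      moreover have "insert r (insert z (insert c (Q - {q}))) \<subseteq> N q"
        using bridge_neighbourhood(2)[OF assms, of q] q f[OF q(1)] z N_sym[of q c] by (auto simp: Q_def)
      then have "card (insert r (insert z (insert c (Q - {q})))) \<le> card (N q)"
        by (intro card_mono) auto
      ultimately show False using card_N_le[of q] q N_in_W by (fastforce simp: Q_def)
    qed
    then show ?thesis using q f[OF q(1)] N_sym[of "f q" q] by (auto simp: bridge_def Q_def)
  qed
  ultimately show ?thesis using that by blast
qed

text \<open>
  The two cliques at the ends of a bridge cover \<open>2 * D\<close> vertices and leave at most \<open>D + 2\<close>. This is
  less than the \<open>2 * (D - 1)\<close> bridges that enter the rest, so two of them, coming from
  different cliques, end in the same vertex.
\<close>

lemma inconsistent: False
proof -
  obtain u v c where uvc: "u \<noteq> v" "v \<notin> N u" "c \<in> N u" "c \<in> N v"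
    by (rule exists_path_of_length_two)
  then obtain w where "w \<in> N c" "N c \<inter> N w = {}"
    using neighbourhood_structure[of u c v] N_sym[of c u] N_sym[of c v] by metis
  then have b: "bridge c w" by (simp add: bridge_def)
  let ?R = "W - (N c \<union> N w)"
  obtain F where F: "F \<subseteq> ?R" "card F = D - 1" "\<And>r. r \<in> F \<Longrightarrow> \<exists>q\<in>N c. bridge r q"
    using bridges_leaving_clique[OF b] by metis
  obtain F' where F': "F' \<subseteq> ?R" "card F' = D - 1" "\<And>r. r \<in> F' \<Longrightarrow> \<exists>q\<in>N w. bridge r q"
    using bridges_leaving_clique[OF bridge_sym[OF b]] by (metis Un_commute)
  have disj: "N c \<inter> N w = {}" using b by (simp add: bridge_def)
  have "card ?R = card W - card (N c \<union> N w)"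
    using N_subset by (intro card_Diff_subset) auto
  also have "card (N c \<union> N w) = 2 * D"
    using bridge_neighbourhood(1)[OF b] bridge_neighbourhood(1)[OF bridge_sym[OF b]]
    by (subst card_Un_disjoint) (use disj in auto)
  finally have R: "card ?R \<le> D + 2" using card_W by linarith
  have fin: "finite ?R" using finite_W by simp
  have "F \<inter> F' \<noteq> {}"
  proof
    assume "F \<inter> F' = {}"
    then have "card F + card F' = card (F \<union> F')"
      using F(1) F'(1) fin by (metis card_Un_disjoint finite_subset)
    also have "\<dots> \<le> card ?R" using F(1) F'(1) fin by (intro card_mono) auto
    finally show False using F(2) F'(2) R D_ge by linarith
  qed
  then obtain r where "r \<in> F" "r \<in> F'" by blast
  then obtain p q where "q \<in> N c" "p \<in> N w" "bridge r q" "bridge r p"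
    using F(3) F'(3) by blast
  then show False using bridge_unique disj by blast
qed

end

section \<open>The upper bound\<close>

text \<open>
  This is the neighbourhood of \<open>y\<close> in the complement of the link of \<open>x\<close>. Requiring
  \<open>y \<in> verts G - {x}\<close> inside the set makes the adjacency relation symmetric for all arguments.
\<close>

definition non_link :: "'a hypergraph \<Rightarrow> 'a \<Rightarrow> 'a \<Rightarrow> 'a set" where
  "non_link G x y = {z \<in> verts G - {x}. y \<in> verts G - {x} \<and> z \<noteq> y \<and> {x, y, z} \<notin> edges G}"

lemma card_non_link:
  assumes G: "three_graph G" and x: "x \<in> verts G" and y: "y \<in> verts G - {x}"
  shows "card (non_link G x y) + codegree G x y + 2 = card (verts G)"
proof -
  let ?L = "{z \<in> verts G. {x, y, z} \<in> edges G}"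
  have fin: "finite (verts G)" using G by (simp add: three_graph_def)
  have L: "x \<notin> ?L" "y \<notin> ?L" using edge_distinct[OF G, of x y] by blast+
  have "verts G = (non_link G x y \<union> ?L) \<union> {x, y}"
    using x y L by (auto simp: non_link_def)
  then have "card (verts G) = card ((non_link G x y \<union> ?L) \<union> {x, y})" by simp
  also have "\<dots> = card (non_link G x y \<union> ?L) + card {x, y}"
    using fin L by (intro card_Un_disjoint) (auto simp: non_link_def)
  also have "card (non_link G x y \<union> ?L) = card (non_link G x y) + card ?L"
    using fin by (intro card_Un_disjoint) (auto simp: non_link_def)
  finally show ?thesis
    using y codegree_eq_card_third_vertices[OF G, of x y] by auto
qed

text \<open>
  A third vertex \<open>w\<close> of an edge with \<open>y\<close> and \<open>z\<close> is \<open>x\<close> itself or lies in one of the two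
  neighbourhoods, since otherwise all four triples of \<open>x, y, z, w\<close> are edges. The intersection
  appears because the union of the neighbourhoods is counted.
\<close>

lemma codegree_le_of_uncovered:
  assumes G: "three_graph G" and x: "x \<in> verts G"
    and no: "\<not> (\<exists>H. copy_of K4 G H \<and> x \<in> verts H)"
    and yz: "{x, y, z} \<in> edges G"
  shows "codegree G y z + card (non_link G x y \<inter> non_link G x z)
    \<le> 1 + card (non_link G x y) + card (non_link G x z)"
proof -
  let ?N = "non_link G x"
  let ?K = "{w \<in> verts G. {y, z, w} \<in> edges G}"
  have fin: "finite (?N a)" for a
    using G by (auto simp: three_graph_def non_link_def)
  note d = edge_distinct[OF G yz]
  have "?K \<subseteq> insert x (?N y \<union> ?N z)"
  proof
    fix w assume w: "w \<in> ?K"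
    then have dw: "y \<noteq> w" "z \<noteq> w" using edge_distinct[OF G, of y z w] by auto
    show "w \<in> insert x (?N y \<union> ?N z)"
    proof (rule ccontr)
      assume "\<not> ?thesis"
      then have e: "{x, y, w} \<in> edges G" "{x, z, w} \<in> edges G" "w \<noteq> x"
        using w d dw by (auto simp: non_link_def)
      let ?S = "{x, y, z, w}"
      have cS: "card ?S = 4" using d dw e by auto
      have faces: "e' \<in> edges G" if e': "e' \<subseteq> ?S" "card e' = 3" for e'
      proof -
        have "card (?S - e') = 1" using e' cS by (subst card_Diff_subset) (auto intro: finite_subset)
        then obtain a where a: "?S - e' = {a}" by (auto simp: card_1_singleton_iff)
        have "e' = ?S - {a}" using a e' by blast
        moreover have "a \<in> ?S" using a by blast
        moreover have "?S - {x} = {y, z, w}" "?S - {y} = {x, z, w}"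
          "?S - {z} = {x, y, w}" "?S - {w} = {x, y, z}" using d dw e by auto
        ultimately have "e' \<in> {{y, z, w}, {x, z, w}, {x, y, w}, {x, y, z}}" by auto
        then show ?thesis using w e yz by auto
      qed
      have "?S \<subseteq> verts G" "x \<in> ?S" using d w by simp_all
      with cS faces have "\<exists>S\<subseteq>verts G. card S = 4 \<and> x \<in> S \<and> (\<forall>e\<subseteq>S. card e = 3 \<longrightarrow> e \<in> edges G)"
        by metis
      then show False using no unfolding in_copy_of_K4_iff by (rule notE[rotated])
    qed
  qed
  then have "card ?K \<le> card (insert x (?N y \<union> ?N z))"
    using fin by (intro card_mono) auto
  also have "\<dots> \<le> 1 + card (?N y \<union> ?N z)" using fin by (simp add: card_insert_if)
  finally have "codegree G y z \<le> 1 + card (?N y \<union> ?N z)"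
    using codegree_eq_card_third_vertices[OF G, of y z] d by simp
  then show ?thesis using card_Un_Int[OF fin fin, of y z] by linarith
qed

text \<open>
  The first bound compares the codegree of \<open>y\<close> and \<open>z\<close> in a single edge through the uncovered vertex
  with the bound \<open>n - 2 - m\<close> on the degrees in the complement of the link. If the second
  bound fails, \<open>3 * m\<close> is \<open>2 * n - 3\<close> or \<open>2 * n - 4\<close>, and the complement of the link meets
  the contradictory requirements above. There \<open>3 * D \<ge> n - 3\<close>, so \<open>n \<ge> 18\<close> ensures \<open>D \<ge> 5\<close>.
\<close>

lemma min_codegree_le_of_no_covering:
  assumes G: "three_graph G" and n: "card (verts G) = n" "4 \<le> n" and cov: "\<not> has_covering K4 G"
  shows "3 * min_codegree G + 3 \<le> 2 * n"
    and "18 \<le> n \<Longrightarrow> 3 * min_codegree G + 5 \<le> 2 * n"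
proof -
  define m where "m = min_codegree G"
  obtain x where x: "x \<in> verts G" "\<not> (\<exists>H. copy_of K4 G H \<and> x \<in> verts H)"
    using cov by (auto simp: has_covering_def)
  have fin: "finite (verts G)" using G by (simp add: three_graph_def)
  have m: "m \<le> codegree G a b" if "a \<in> verts G" "b \<in> verts G" "a \<noteq> b" for a b
    using min_codegree_ge_iff[OF G, of m] n that by (auto simp: m_def)
  let ?W = "verts G - {x}" and ?N = "non_link G x"
  have card_N: "card (?N y) + m + 2 \<le> n" if "y \<in> ?W" for y
    using card_non_link[OF G x(1) that] m[of x y] that x(1) n by auto
  have co: "m + card (?N y \<inter> ?N z) \<le> 1 + card (?N y) + card (?N z)"
    if "y \<in> ?W" "z \<in> ?W" "y \<noteq> z" "z \<notin> ?N y" for y z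
    using codegree_le_of_uncovered[OF G x, of y z] that m[of y z] by (auto simp: non_link_def)
  have cW: "card ?W + 1 = n" using x fin n by simp
  have "3 * m + 3 \<le> 2 * n"
  proof (cases "m = 0")
    case False
    have "?W \<noteq> {}" using cW n by (metis card.empty add_0 numeral_le_one_iff semiring_norm(69))
    then obtain y where y: "y \<in> ?W" by blast
    have "codegree G x y > 0" using m[of x y] x y False by auto
    then have "{z \<in> verts G. {x, y, z} \<in> edges G} \<noteq> {}"
      using codegree_eq_card_third_vertices[OF G, of x y] y by (metis DiffD2 card.empty less_irrefl singletonI)
    then obtain z where z: "z \<in> verts G" "{x, y, z} \<in> edges G" by blast
    then have "z \<in> ?W" "y \<noteq> z" "z \<notin> ?N y"
      using edge_distinct[OF G z(2)] by (auto simp: non_link_def)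
    then show ?thesis using co[OF y] card_N[OF y] card_N[of z] by fastforce
  qed (use n in simp)
  then show "3 * min_codegree G + 3 \<le> 2 * n" by (simp add: m_def)
  assume n18: "18 \<le> n"
  show "3 * min_codegree G + 5 \<le> 2 * n"
  proof (rule ccontr)
    assume "\<not> ?thesis"
    then have big: "2 * n \<le> 3 * m + 4" by (simp add: m_def)
    define D where "D = n - 2 - m"
    define s where "s = 2 * n - 3 - 3 * m"
    have D: "D + m + 2 = n" using \<open>3 * m + 3 \<le> 2 * n\<close> n by (simp add: D_def)
    have s: "s + 3 + 3 * m = 2 * n" using \<open>3 * m + 3 \<le> 2 * n\<close> by (simp add: s_def)
    interpret near_clique_union ?W ?N D s
    proof
      show "finite ?W" using fin by simp
      show "?N v \<subseteq> ?W" "v \<notin> ?N v" for v by (auto simp: non_link_def)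
      show "u \<in> ?N v \<Longrightarrow> v \<in> ?N u" for u v
        by (auto simp: non_link_def insert_commute)
      show "5 \<le> D" using D s big n18 by linarith
      show "s \<le> 1" using s big by linarith
      show "card ?W + s = 3 * D + 2" using cW D s by linarith
      show "card (?N v) \<le> D" if "v \<in> ?W" for v using card_N[OF that] D by linarith
      show "2 * D + card (?N u \<inter> ?N v) \<le> card (?N u) + card (?N v) + s"
        if "u \<in> ?W" "v \<in> ?W" "u \<noteq> v" "v \<notin> ?N u" for u v
        using co[OF that] D s by linarith
    qed
    show False by (rule inconsistent)
  qed
qed

section \<open>The lower bound\<close>

lemma card_residue_class_le: "card {i \<in> {..<N}. i mod 3 = r} \<le> (N + 2) div 3" for N r :: nat
proof -
  have "{i \<in> {..<N}. i mod 3 = r} \<subseteq> (\<lambda>j. 3 * j + r) ` {..<(N + 2) div 3}"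
  proof
    fix i assume "i \<in> {i \<in> {..<N}. i mod 3 = r}"
    then have "i = 3 * (i div 3) + r" "i div 3 < (N + 2) div 3" by auto
    then show "i \<in> (\<lambda>j. 3 * j + r) ` {..<(N + 2) div 3}" by blast
  qed
  then have "card {i \<in> {..<N}. i mod 3 = r} \<le> card ((\<lambda>j. 3 * j + r) ` {..<(N + 2) div 3})"
    by (intro card_mono) auto
  also have "\<dots> \<le> card {..<(N + 2) div 3}" by (rule card_image_le) simp
  finally show ?thesis by simp
qed

text \<open>
  The vertex \<open>N\<close> is the apex, to be left uncovered; the other vertices are divided into parts by
  their residue modulo 3. The single equivalence covers both kinds of triples: one through the
  apex is an edge iff its other two vertices lie in different parts, and one that avoids the apex
  is an edge iff two of its vertices lie in the same part.
\<close>

definition tripartite_example :: "nat \<Rightarrow> nat hypergraph" where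
  "tripartite_example N = \<lparr>verts = {..N},
     edges = {e. e \<subseteq> {..N} \<and> card e = 3 \<and> (inj_on (\<lambda>i. i mod 3) (e - {N}) \<longleftrightarrow> N \<in> e)}\<rparr>"

lemma verts_example [simp]: "verts (tripartite_example N) = {..N}"
  by (simp add: tripartite_example_def)

lemma three_graph_example: "three_graph (tripartite_example N)"
  by (auto simp: three_graph_def tripartite_example_def)

text \<open>
  In a \<open>K4\<close> through the apex, the faces at the apex put the other three vertices into three different
  parts, so the opposite face is not an edge.
\<close>

lemma example_no_covering: "\<not> has_covering K4 (tripartite_example N)"
proof
  let ?G = "tripartite_example N"
  assume "has_covering K4 ?G"
  then have "\<exists>H. copy_of K4 ?G H \<and> N \<in> verts H"
    by (simp add: has_covering_def)
  then obtain S where S: "card S = 4" "N \<in> S"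
    and E: "\<And>e. e \<subseteq> S \<Longrightarrow> card e = 3 \<Longrightarrow> e \<in> edges ?G"
    unfolding in_copy_of_K4_iff by blast
  have fin: "finite S" using S(1) card.infinite by fastforce
  have "inj_on (\<lambda>i. i mod 3) (S - {N})"
  proof (rule inj_onI, rule ccontr)
    fix a b assume ab: "a \<in> S - {N}" "b \<in> S - {N}" "a mod 3 = b mod 3" "a \<noteq> b"
    then have "card {N, a, b} = 3" "{N, a, b} \<subseteq> S" using S by auto
    then have "inj_on (\<lambda>i. i mod 3) ({N, a, b} - {N})"
      using E[of "{N, a, b}"] by (simp add: tripartite_example_def)
    then have "a = b" by (rule inj_onD) (use ab in blast)+
    then show False using ab by simp
  qed
  moreover have "card (S - {N}) = 3" using S fin by simp
  then have "S - {N} \<in> edges ?G" by (intro E Diff_subset)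
  ultimately show False by (simp add: tripartite_example_def)
qed

lemma example_edges:
  shows "c < N \<Longrightarrow> d < N \<Longrightarrow> c mod 3 \<noteq> d mod 3 \<Longrightarrow> {N, c, d} \<in> edges (tripartite_example N)"
    and "c < N \<Longrightarrow> d < N \<Longrightarrow> e < N \<Longrightarrow> c \<noteq> d \<Longrightarrow> c \<noteq> e \<Longrightarrow> d \<noteq> e \<Longrightarrow> d mod 3 = e mod 3
      \<Longrightarrow> {c, d, e} \<in> edges (tripartite_example N)"
proof -
  assume cd: "c < N" "d < N" "c mod 3 \<noteq> d mod 3"
  have inj: "inj_on f ({N, c, d} - {N})" if "f c \<noteq> f d" for f :: "nat \<Rightarrow> nat"
    using that by (auto simp: inj_on_def)
  have "inj_on (\<lambda>i. i mod 3) ({N, c, d} - {N})"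
    by (rule inj[where f = "\<lambda>i. i mod 3", OF cd(3)])
  moreover have "N \<noteq> c" "N \<noteq> d" "c \<noteq> d" using cd by blast+
  then have "card {N, c, d} = 3" by simp
  ultimately show "{N, c, d} \<in> edges (tripartite_example N)"
    using cd(1,2) by (simp add: tripartite_example_def)
next
  assume le: "c < N" "d < N" "e < N" and ne: "c \<noteq> d" "c \<noteq> e" "d \<noteq> e" and eq: "d mod 3 = e mod 3"
  have "\<not> inj_on (\<lambda>i. i mod 3) ({c, d, e} - {N})"
  proof
    assume "inj_on (\<lambda>i. i mod 3) ({c, d, e} - {N})"
    then have "d = e" using eq by (rule inj_onD) (use le in blast)+
    then show False using ne by simp
  qed
  moreover have "card {c, d, e} = 3" "N \<notin> {c, d, e}" using ne le by auto
  ultimately show "{c, d, e} \<in> edges (tripartite_example N)"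
    using le by (simp add: tripartite_example_def)
qed

text \<open>
  For each kind of pair, the vertices that do not complete it to an edge are contained in a set
  \<open>B\<close> that consists of at most one part and at most two further vertices, or of three vertices.
\<close>

lemma example_codegree:
  assumes ab: "a \<le> N" "b \<le> N" "a \<noteq> b" and "3 \<le> N"
  shows "(2 * N - 3) div 3 \<le> codegree (tripartite_example N) a b"
proof -
  let ?G = "tripartite_example N"
  define C where "C = (\<lambda>r. {i \<in> {..<N}. i mod 3 = r})"
  have C: "card (C r) \<le> (N + 2) div 3" for r
    unfolding C_def by (rule card_residue_class_le)
  have finC: "finite (C r)" for r by (simp add: C_def)
  have fin: "finite {c \<in> verts ?G. {a, b, c} \<in> edges ?G}" by simp
  have via: "N + 1 \<le> card B + codegree ?G a b"
    if "\<And>c. c \<le> N \<Longrightarrow> c \<notin> B \<Longrightarrow> {a, b, c} \<in> edges ?G" "finite B" for B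
  proof -
    have "{..N} \<subseteq> B \<union> {c \<in> verts ?G. {a, b, c} \<in> edges ?G}"
      using that(1) by auto
    then have "card {..N} \<le> card (B \<union> {c \<in> verts ?G. {a, b, c} \<in> edges ?G})"
      using fin that(2) by (intro card_mono) auto
    then show ?thesis
      using card_Un_le[of B "{c \<in> verts ?G. {a, b, c} \<in> edges ?G}"]
        codegree_eq_card_third_vertices[OF three_graph_example ab(3), of N] by simp
  qed
  consider "N \<in> {a, b}" | "a < N" "b < N" "a mod 3 = b mod 3" | "a < N" "b < N" "a mod 3 \<noteq> b mod 3"
    using ab by fastforce
  then show ?thesis
  proof cases
    case 1
    define d where "d = (if a = N then b else a)"
    have d: "d < N" "{a, b} = {N, d}" using 1 ab by (auto simp: d_def)
    let ?B = "insert N (C (d mod 3))"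
    have "{a, b, c} \<in> edges ?G" if "c \<le> N" "c \<notin> ?B" for c
    proof -
      have c: "c < N" "c mod 3 \<noteq> d mod 3" using that by (auto simp: C_def)
      have "{a, b, c} = {N, d, c}" using d(2) by blast
      moreover have "{N, d, c} \<in> edges ?G" using example_edges(1)[OF d(1) c(1)] c(2) by simp
      ultimately show ?thesis by simp
    qed
    then have "N + 1 \<le> card ?B + codegree ?G a b" using finC by (intro via) auto
    moreover have "card ?B \<le> card (C (d mod 3)) + 1" using finC by (simp add: card_insert_if)
    ultimately show ?thesis using C[of "d mod 3"] by linarith
  next
    case 2
    have "{a, b, c} \<in> edges ?G" if "c \<le> N" "c \<notin> {a, b, N}" for c
      using example_edges(2)[of c N a b] 2 that ab(3) by (simp add: insert_commute)
    then have "N + 1 \<le> card {a, b, N} + codegree ?G a b" by (intro via) auto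
    moreover have "card {a, b, N} \<le> 3" by (simp add: card_insert_if)
    ultimately show ?thesis using \<open>3 \<le> N\<close> by linarith
  next
    case 3
    \<comment> \<open>The residues 0, 1, 2 add up to 3, so this is the residue of the third part.\<close>
    define r where "r = 3 - a mod 3 - b mod 3"
    let ?B = "insert a (insert b (C r))"
    have "{a, b, c} \<in> edges ?G" if "c \<le> N" "c \<notin> ?B" for c
    proof (cases "c = N")
      case True
      then show ?thesis using example_edges(1)[OF 3] by (simp add: insert_commute)
    next
      case False
      then have "c mod 3 \<noteq> r" "c < N" using that by (auto simp: C_def)
      then have c: "c < N" "c \<noteq> a" "c \<noteq> b" using that by auto
      have "c mod 3 \<noteq> 3 - a mod 3 - b mod 3" using \<open>c mod 3 \<noteq> r\<close> by (simp add: r_def)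
      moreover have "a mod 3 < 3" "b mod 3 < 3" "c mod 3 < 3" by simp_all
      ultimately have "c mod 3 = a mod 3 \<or> c mod 3 = b mod 3"
        using 3(3) by linarith
      then show ?thesis
      proof
        assume "c mod 3 = a mod 3"
        then show ?thesis
          using example_edges(2)[of b N a c] 3(1,2) c ab(3) by (simp add: insert_commute)
      next
        assume "c mod 3 = b mod 3"
        then show ?thesis
          using example_edges(2)[of a N b c] 3(1,2) c ab(3) by simp
      qed
    qed
    then have "N + 1 \<le> card ?B + codegree ?G a b" using finC by (intro via) auto
    moreover have "card ?B \<le> card (C r) + 2" using finC by (simp add: card_insert_if)
    ultimately show ?thesis using C[of r] \<open>3 \<le> N\<close> by linarith
  qed
qed

section \<open>The covering threshold\<close>

theorem theorem1p1:
  shows "(\<forall>n::nat. n \<ge> 4 \<longrightarrow>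
            \<lfloor>(2 * real n - 5) / 3\<rfloor> \<le> int (c2 n K4) \<and>
            int (c2 n K4) \<le> \<lfloor>(2 * real n - 3) / 3\<rfloor>) \<and>
         (\<forall>n::nat. n > 98 \<longrightarrow> int (c2 n K4) = \<lfloor>(2 * real n - 5) / 3\<rfloor>)"
proof -
  have main: "2 * n < 3 * c2 n K4 + 8"
    "3 * c2 n K4 + 3 \<le> 2 * n" "18 \<le> n \<Longrightarrow> 3 * c2 n K4 + 5 \<le> 2 * n" if n: "4 \<le> n" for n
  proof -
    let ?S = "{min_codegree G | G :: nat hypergraph.
      three_graph G \<and> card (verts G) = n \<and> \<not> has_covering K4 G}"
    have "?S \<subseteq> {..n}" using min_codegree_le_of_no_covering(1)[OF _ _ n] by fastforce
    then have fin: "finite ?S" by (rule finite_subset) simp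
    let ?G = "tripartite_example (n - 1)"
    have G: "three_graph ?G" "card (verts ?G) = n" "\<not> has_covering K4 ?G"
      using three_graph_example example_no_covering n by auto
    then have G_in: "min_codegree ?G \<in> ?S" by blast
    have "(2 * (n - 1) - 3) div 3 \<le> min_codegree ?G"
      using n G by (subst min_codegree_ge_iff) (auto intro!: example_codegree)
    also have "\<dots> \<le> c2 n K4" unfolding c2_def using fin G_in by (rule Max_ge)
    finally have "(2 * (n - 1) - 3) div 3 \<le> c2 n K4" .
    moreover have "2 * (n - 1) - 3 = 2 * n - 5" by simp
    ultimately have "(2 * n - 5) div 3 < c2 n K4 + 1" by simp
    then have "2 * n - 5 < (c2 n K4 + 1) * 3" by (subst (asm) div_less_iff_less_mult) simp_all
    then show "2 * n < 3 * c2 n K4 + 8" using n by simp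
    have "c2 n K4 \<in> ?S" unfolding c2_def using fin G_in by (intro Max_in) auto
    then obtain H :: "nat hypergraph" where H: "three_graph H" "card (verts H) = n"
      "\<not> has_covering K4 H" "c2 n K4 = min_codegree H" by blast
    show "3 * c2 n K4 + 3 \<le> 2 * n" "18 \<le> n \<Longrightarrow> 3 * c2 n K4 + 5 \<le> 2 * n"
      using min_codegree_le_of_no_covering[OF H(1,2) n H(3)] H(4) by auto
  qed
  have lower: "\<lfloor>(2 * real n - 5) / 3\<rfloor> \<le> int (c2 n K4)" if "4 \<le> n" for n
  proof -
    have "\<lfloor>(2 * real n - 5) / 3\<rfloor> < int (c2 n K4) + 1"
      using main(1)[OF that] by (simp add: floor_less_iff field_simps)
    then show ?thesis by simp
  qed
  have "int (c2 n K4) \<le> \<lfloor>(2 * real n - 3) / 3\<rfloor>" if "4 \<le> n" for n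
    using main(2)[OF that] by (simp add: le_floor_iff field_simps)
  moreover have "int (c2 n K4) = \<lfloor>(2 * real n - 5) / 3\<rfloor>" if "98 < n" for n
  proof (rule antisym)
    show "int (c2 n K4) \<le> \<lfloor>(2 * real n - 5) / 3\<rfloor>"
      using main(3)[of n] that by (simp add: le_floor_iff field_simps)
    show "\<lfloor>(2 * real n - 5) / 3\<rfloor> \<le> int (c2 n K4)" using lower that by simp
  qed
  ultimately show ?thesis using lower by blast
qed

end
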